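(* Let $\theta\in(0,1]$, $r=1$, and let $\{Z_n\}_{n\ge0}$ be a GW$^{\,\theta}$-process with parameters $(\theta,1,a_n,c_n)_{n\ge1}$. Assume that $\lim_{n\to\infty} B_n$ does not exist (neither as a finite nor as an infinite limit). Then $q=1$, and letting $B_{k_n}\to B\in[0,\infty]$ along a subsequence $k_n\to\infty$, we get: (i) if $B=\infty$, then $$\mathrm{P}(Z_{k_n}>0)\sim C_{k_n}^{-1/\theta},\qquad \mathrm{E}(Z_{k_n}|Z_{k_n}>0)\sim B_{k_n}^{1/\theta},$$ and with $\lambda_n=\lambda B_n^{-1/\theta}$, $$\mathrm{E}(e^{-\lambda_{k_n}Z_{k_n}}|Z_{k_n}>0)\to1-(1+\lambda^{-\theta})^{-1/\theta},\quad\lambda\ge0;$$ (ii) if $B\in[0,\infty)$, then $A_{k_n}\to\infty$, $$\mathrm{P}(Z_{k_n}>0)\sim(1+B)^{-1/\theta}A_{k_n}^{-1/\theta},\qquad \mathrm{E}(Z_{k_n}|Z_{k_n}>0)\to(1+B)^{1/\theta},$$ and $$\mathrm{E}(s^{Z_{k_n}}|Z_{k_n}>0)\to 1-((1+B)(1-s)^{-\theta}+B+B^2)^{-1/\theta},\quad 0\le s\le1.$$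
   Context: All limits and asymptotic equivalences are as $n\to\infty$. Let $\theta\in(0,1]$, $r=1$, and let $(a_n,c_n)_{n\ge1}$ be real sequences with $0<a_n<\infty$, $c_n>0$, $c_n\ge 1-a_n$ for all $n\ge1$. Put $$f_n(s)=1-(a_n(1-s)^{-\theta}+c_n)^{-1/\theta},\quad 0\le s<1,\qquad f_n(1)=1.$$ Each $f_n(s)=\sum_{j\ge0}p_n(j)s^j$ is a probability generating function. The GW$^{\,\theta}$-process with parameters $(\theta,1,a_n,c_n)_{n\ge1}$ is the Galton-Watson process in a varying environment $\{Z_n\}_{n\ge0}$ with $Z_0=1$, $Z_n=\sum_{i=1}^{Z_{n-1}}X_{n,i}$, where $\{X_{n,i}\}_{n,i\ge1}$ are independent and $\mathrm{P}(X_{n,i}=j)=p_n(j)$. Thus $\mathrm{E}(s^{Z_n})=f_1\circ\cdots\circ f_n(s)$. The extinction probability is $q=\lim \mathrm{P}(Z_n=0)$. Notation: $A_0=1$, $A_n=\prod_{i=1}^n a_i$, $C_n=\sum_{i=1}^n A_{i-1}c_i$, $B_n=C_n/A_n$. Conventions: $0^{-\theta}=\infty$, $\infty^{-1/\theta}=0$.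
   Formalization: The last limit in (ii) is corrected to 1-(((1-s)^{-θ}+B)/(1+B))^{-1/θ}; the printed formula is false for every B>0, since at s=0 it gives 1-(1+B)^{-2/θ}>0 while E(0^Z|Z>0)=0. *)

theory Defs
  imports "HOL-Probability.Probability" "HOL-Library.Landau_Symbols"
begin

(* (a x^(-\<theta>) + c)^(-1/\<theta>) for x \<ge> 0 under the conventions 0^(-\<theta>) = \<infinity> and \<infinity>^(-1/\<theta>) = 0.
   The case x = 0 is separate because HOL has 0 powr y = 0. *)
definition theta_map :: "real \<Rightarrow> real \<Rightarrow> real \<Rightarrow> real \<Rightarrow> real" where
  "theta_map \<theta> a c x = (if x = 0 then 0 else (a * x powr (-\<theta>) + c) powr (-1/\<theta>))"

definition theta_pgf :: "real \<Rightarrow> real \<Rightarrow> real \<Rightarrow> real \<Rightarrow> real" where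
  "theta_pgf \<theta> a c s = 1 - theta_map \<theta> a c (1 - s)"

definition env_A :: "(nat \<Rightarrow> real) \<Rightarrow> nat \<Rightarrow> real" where
  "env_A a n = (\<Prod>i=1..n. a i)"

definition env_C :: "(nat \<Rightarrow> real) \<Rightarrow> (nat \<Rightarrow> real) \<Rightarrow> nat \<Rightarrow> real" where
  "env_C a c n = (\<Sum>i=1..n. env_A a (i - 1) * c i)"

definition env_B :: "(nat \<Rightarrow> real) \<Rightarrow> (nat \<Rightarrow> real) \<Rightarrow> nat \<Rightarrow> real" where
  "env_B a c n = env_C a c n / env_A a n"

(* GW^\<theta>-process with parameters (\<theta>, 1, a n, c n) for n \<ge> 1. X n i is the offspring number of the
   i-th individual of generation n - 1 and p n its law, the coefficient sequence of the
   probability generating function theta_pgf \<theta> (a n) (c n). Values of a, c, p, X at index 0 are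
   irrelevant. *)
locale gw_theta_process = prob_space M for M :: "'w measure" +
  fixes \<theta> :: real and a c :: "nat \<Rightarrow> real"
    and p :: "nat \<Rightarrow> nat \<Rightarrow> real"
    and X :: "nat \<Rightarrow> nat \<Rightarrow> 'w \<Rightarrow> nat"
    and Z :: "nat \<Rightarrow> 'w \<Rightarrow> nat"
  assumes theta_pos: "0 < \<theta>" and theta_le_1: "\<theta> \<le> 1"
    and a_pos: "\<And>n. n \<ge> 1 \<Longrightarrow> a n > 0"
    and c_pos: "\<And>n. n \<ge> 1 \<Longrightarrow> c n > 0"
    and c_ge: "\<And>n. n \<ge> 1 \<Longrightarrow> c n \<ge> 1 - a n"
    and offspring_pgf: "\<And>n s. n \<ge> 1 \<Longrightarrow> 0 \<le> s \<Longrightarrow> s \<le> 1 \<Longrightarrow>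
          (\<lambda>j. p n j * s ^ j) sums theta_pgf \<theta> (a n) (c n) s"
    and offspring_indep:
          "indep_vars (\<lambda>_. count_space UNIV) (\<lambda>(n, i). X n i) ({1..} \<times> {1..})"
    and offspring_law: "\<And>n i j. n \<ge> 1 \<Longrightarrow> i \<ge> 1 \<Longrightarrow> \<P>(w in M. X n i w = j) = p n j"
    and Z_0: "\<And>w. w \<in> space M \<Longrightarrow> Z 0 w = 1"
    and Z_Suc: "\<And>n w. w \<in> space M \<Longrightarrow> Z (Suc n) w = (\<Sum>i=1..Z n w. X (Suc n) i w)"

(* P(Z n = 0) is nondecreasing in n for a Galton-Watson process, so the limit exists. *)
definition extinction_prob :: "'w measure \<Rightarrow> (nat \<Rightarrow> 'w \<Rightarrow> nat) \<Rightarrow> real" where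
  "extinction_prob M Z = lim (\<lambda>n. \<P>(w in M. Z n w = 0))"

(* E(Y | P). Despite its name, uniform_measure M A is the conditional measure
   B \<mapsto> M (A \<inter> B) / M A. *)
definition cond_expect :: "'w measure \<Rightarrow> ('w \<Rightarrow> real) \<Rightarrow> ('w \<Rightarrow> bool) \<Rightarrow> real" where
  "cond_expect M Y P = integral\<^sup>L (uniform_measure M {w \<in> space M. P w}) Y"

(* Limit of E(s^Z | Z > 0) along times where env_B tends to b < \<infinity>:
     1 - (((1 - s)^(-\<theta>) + b) / (1 + b))^(-1/\<theta>).
   This corrects a misprint in the source, which has
     1 - ((1 + b) (1 - s)^(-\<theta>) + b + b^2)^(-1/\<theta>),
   that is, a factor (1 + b) in place of 1 / (1 + b). The source's formula is wrong for every b > 0: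
   at s = 0 it is 1 - (1 + b)^(-2/\<theta>) > 0, whereas E(0^Z | Z > 0) = 0. The two formulas agree
   for b = 0. *)
definition cond_limit_pgf :: "real \<Rightarrow> real \<Rightarrow> real \<Rightarrow> real" where
  "cond_limit_pgf \<theta> b s = 1 - theta_map \<theta> (1 / (1 + b)) (b / (1 + b)) (1 - s)"

end

theory Submission
  imports Defs
begin

text \<open>
  In the coordinate \<open>y = (1 - s) powr (-\<theta>)\<close> the offspring generating functions are the affine
  maps \<open>y \<mapsto> a n * y + c n\<close>, so their composition is the affine map with coefficients
  \<open>A n\<close> and \<open>C n\<close>. Hence survival probability, mean and conditional generating function at time
  \<open>n\<close> are explicit functions of \<open>A n\<close> and \<open>B n\<close>, and all limits follow by continuity once
  \<open>A n + C n\<close> tends to infinity. The latter holds since \<open>A n + C n\<close> and \<open>C n\<close> are nondecreasing: if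
  they were bounded, \<open>B n\<close> would converge.
\<close>

section \<open>Algebra of \<open>theta_map\<close> and of the environment sequences\<close>

lemma theta_map_0 [simp]: "theta_map \<theta> a c 0 = 0"
  by (simp add: theta_map_def)

lemma theta_map_nonneg [simp]: "0 \<le> theta_map \<theta> a c x"
  by (simp add: theta_map_def)

text \<open>Both exponents are negative, so \<open>x \<le> 1\<close> forces the base to be at least
  \<open>a + c \<ge> 1\<close>. This keeps the offspring generating functions inside [0, 1], where
  they can be iterated.\<close>

lemma theta_map_le_1:
  assumes "0 < \<theta>" "0 \<le> a" "1 \<le> a + c" "0 \<le> x" "x \<le> 1"
  shows "theta_map \<theta> a c x \<le> 1"
proof (cases "x = 0")
  case False
  then have "1 powr (-\<theta>) \<le> x powr (-\<theta>)"
    using assms by (intro powr_mono2') auto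
  then have "a * 1 \<le> a * x powr (-\<theta>)"
    using assms(2) by (intro mult_left_mono) auto
  then have "1 \<le> a * x powr (-\<theta>) + c"
    using assms(3) by linarith
  then have "(a * x powr (-\<theta>) + c) powr (-1/\<theta>) \<le> 1 powr (-1/\<theta>)"
    using assms(1) by (intro powr_mono2') auto
  then show ?thesis
    using False by (simp add: theta_map_def)
qed simp

text \<open>The outer power -\<theta> undoes the inner power -1/\<theta>, which leaves a composition
  of affine maps. Positivity of the inner base keeps the inner value off the branch at 0.\<close>

lemma theta_map_comp:
  assumes "\<theta> \<noteq> 0" "0 < a" "0 < a'" "0 \<le> c'" "0 \<le> x"
  shows "theta_map \<theta> a c (theta_map \<theta> a' c' x) = theta_map \<theta> (a * a') (c + a * c') x"
proof (cases "x = 0")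
  case False
  then have pos: "0 < a' * x powr (-\<theta>) + c'"
    using assms by (intro add_pos_nonneg) auto
  then have "((a' * x powr (-\<theta>) + c') powr (-1/\<theta>)) powr (-\<theta>) = a' * x powr (-\<theta>) + c'"
    using assms by (simp add: powr_powr)
  moreover have "(a' * x powr (-\<theta>) + c') powr (-1/\<theta>) \<noteq> 0"
    using pos by simp
  ultimately show ?thesis
    using False by (simp add: theta_map_def algebra_simps)
qed simp

text \<open>The divisor is the value at \<open>x = 1\<close>; the quotient depends only on
  \<open>c / a\<close>. With \<open>env_A\<close> and \<open>env_C\<close> for \<open>a\<close> and
  \<open>c\<close> the divisor is the survival probability and \<open>c / a\<close> is
  \<open>env_B\<close>, so the conditional law is a function of \<open>env_B\<close> alone.\<close>

lemma theta_map_divide: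
  assumes "0 < a" "0 \<le> c" "0 \<le> x"
  shows "theta_map \<theta> a c x / (a + c) powr (-1/\<theta>) =
    theta_map \<theta> (1 / (1 + c/a)) (c/a / (1 + c/a)) x"
proof (cases "x = 0")
  case False
  have "(a * x powr (-\<theta>) + c) powr (-1/\<theta>) / (a + c) powr (-1/\<theta>)
      = ((a * x powr (-\<theta>) + c) / (a + c)) powr (-1/\<theta>)"
    using assms by (subst powr_divide) auto
  also have "(a * x powr (-\<theta>) + c) / (a + c) = 1 / (1 + c/a) * x powr (-\<theta>) + c/a / (1 + c/a)"
    using assms by (simp add: divide_simps)
  finally show ?thesis
    using False by (simp add: theta_map_def)
qed simp

lemma env_A_0 [simp]: "env_A a 0 = 1"
  by (simp add: env_A_def)

lemma env_A_Suc: "env_A a (Suc n) = env_A a n * a (Suc n)"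
  by (simp add: env_A_def prod.nat_ivl_Suc')

lemma env_C_0 [simp]: "env_C a c 0 = 0"
  by (simp add: env_C_def)

lemma env_C_Suc: "env_C a c (Suc n) = env_C a c n + env_A a n * c (Suc n)"
  by (simp add: env_C_def)

section \<open>Sums over the values of a discrete variable, and conditional expectation\<close>

lemma nn_integral_nat_split:
  assumes [measurable]: "Y \<in> M \<rightarrow>\<^sub>M count_space UNIV" "h \<in> borel_measurable M"
  shows "(\<integral>\<^sup>+w. h w \<partial>M) = (\<Sum>k::nat. \<integral>\<^sup>+w. h w * indicator {w. Y w = k} w \<partial>M)"
proof -
  have "(\<Sum>k. h w * indicator {w. Y w = k} w) = h w" for w
    by (subst suminf_finite[of "{Y w}"]) (auto simp: indicator_def)
  then have "(\<integral>\<^sup>+w. h w \<partial>M) = (\<integral>\<^sup>+w. (\<Sum>k. h w * indicator {w. Y w = k} w) \<partial>M)"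
    by simp
  also have "\<dots> = (\<Sum>k. \<integral>\<^sup>+w. h w * indicator {w. Y w = k} w \<partial>M)"
    by (intro nn_integral_suminf) measurable
  finally show ?thesis .
qed

lemma (in prob_space) nn_integral_nat_fun:
  assumes [measurable]: "Y \<in> M \<rightarrow>\<^sub>M count_space UNIV"
  shows "(\<integral>\<^sup>+w. g (Y w) \<partial>M) = (\<Sum>k::nat. g k * ennreal (prob {w \<in> space M. Y w = k}))"
proof -
  have "(\<integral>\<^sup>+w. g (Y w) * indicator {w. Y w = k} w \<partial>M) = g k * ennreal (prob {w \<in> space M. Y w = k})"
    for k
  proof -
    have "(\<integral>\<^sup>+w. g (Y w) * indicator {w. Y w = k} w \<partial>M)
        = (\<integral>\<^sup>+w. g k * indicator {w \<in> space M. Y w = k} w \<partial>M)"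
      by (intro nn_integral_cong) (auto simp: indicator_def)
    also have "\<dots> = g k * emeasure M {w \<in> space M. Y w = k}"
      by (intro nn_integral_cmult_indicator) measurable
    finally show ?thesis
      by (simp add: emeasure_eq_measure)
  qed
  then show ?thesis
    by (subst nn_integral_nat_split[of Y]) auto
qed

lemma (in prob_space) cond_expect_eq:
  assumes [measurable]: "Y \<in> borel_measurable M" "Measurable.pred M P"
    and pos: "0 < prob {w \<in> space M. P w}"
  shows "cond_expect M Y P = expectation (\<lambda>w. Y w * indicator {w. P w} w) / prob {w \<in> space M. P w}"
proof -
  let ?S = "{w \<in> space M. P w}"
  have "uniform_measure M ?S = density M (\<lambda>w. ennreal (indicator ?S w / prob ?S))"
    unfolding uniform_measure_def using pos
    by (intro density_cong AE_I2)
      (auto simp: emeasure_eq_measure divide_ennreal indicator_def simp flip: ennreal_1)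
  then have "cond_expect M Y P = expectation (\<lambda>w. indicator ?S w / prob ?S * Y w)"
    unfolding cond_expect_def by (simp only:) (subst integral_real_density; auto)
  also have "\<dots> = expectation (\<lambda>w. Y w * indicator {w. P w} w / prob ?S)"
    by (intro Bochner_Integration.integral_cong) (auto simp: indicator_def)
  finally show ?thesis
    by simp
qed

section \<open>The offspring array and the generation sizes as functions of it\<close>

context gw_theta_process
begin

lemma measurable_X [measurable]:
  assumes "n \<ge> 1" "i \<ge> 1"
  shows "X n i \<in> M \<rightarrow>\<^sub>M count_space UNIV"
  using offspring_indep assms by (auto simp: indep_vars_def)

lemma nn_integral_offspring:
  assumes "n \<ge> 1" "i \<ge> 1" "0 \<le> s" "s \<le> 1"
  shows "(\<integral>\<^sup>+w. ennreal (s ^ X n i w) \<partial>M) = ennreal (theta_pgf \<theta> (a n) (c n) s)"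
proof -
  have [measurable]: "X n i \<in> M \<rightarrow>\<^sub>M count_space UNIV"
    using assms by simp
  \<comment> \<open>Nonnegativity comes from \<open>p n j\<close> being a probability; it allows the
    passage to \<open>ennreal\<close> below.\<close>
  have nn: "0 \<le> p n j" for j
    using offspring_law[OF assms(1,2), of j, symmetric] by simp
  have "(\<integral>\<^sup>+w. ennreal (s ^ X n i w) \<partial>M) = (\<Sum>j. ennreal (s ^ j) * ennreal (p n j))"
    by (subst nn_integral_nat_fun[of _ "\<lambda>j. ennreal (s ^ j)"]) (auto simp: offspring_law[OF assms(1,2)])
  also have "\<dots> = (\<Sum>j. ennreal (p n j * s ^ j))"
    using assms nn by (simp add: ennreal_mult mult.commute)
  also have "\<dots> = ennreal (theta_pgf \<theta> (a n) (c n) s)"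
    using offspring_pgf[OF assms(1,3,4)] assms nn
    by (subst suminf_ennreal2) (auto simp: sums_iff)
  finally show ?thesis .
qed

text \<open>The generation sizes as functions of the offspring array: a measurable function of an
  infinite family of variables, to which the restriction lemma for independence applies.\<close>

fun gen_size :: "nat \<Rightarrow> (nat \<times> nat \<Rightarrow> nat) \<Rightarrow> nat" where
  "gen_size 0 x = 1"
| "gen_size (Suc n) x = (\<Sum>i=1..gen_size n x. x (Suc n, i))"

lemma measurable_gen_size:
  assumes "{1..n} \<times> {1..} \<subseteq> K"
  shows "gen_size n \<in> PiM K (\<lambda>_. count_space UNIV) \<rightarrow>\<^sub>M count_space UNIV"
  using assms
proof (induction n)
  case 0
  have "gen_size 0 = (\<lambda>_. 1)"
    by (simp add: fun_eq_iff)
  then show ?case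
    by simp
next
  case (Suc n)
  then have [measurable]: "gen_size n \<in> PiM K (\<lambda>_. count_space UNIV) \<rightarrow>\<^sub>M count_space UNIV"
    by (force intro!: Suc.IH)
  have [measurable]: "(\<lambda>x. x (Suc n, i)) \<in> PiM K (\<lambda>_. count_space UNIV) \<rightarrow>\<^sub>M count_space UNIV"
    if "i \<in> {1..k}" for i k
    using that Suc.prems by (intro measurable_component_singleton) auto
  have "(\<lambda>x. \<Sum>i=1..k. x (Suc n, i)) \<in> PiM K (\<lambda>_. count_space UNIV) \<rightarrow>\<^sub>M count_space (UNIV :: nat set)" for k
    by measurable
  \<comment> \<open>The random upper limit takes countably many values, so fixed limits
    \<open>k\<close> suffice.\<close>
  then have "(\<lambda>x. \<Sum>i=1..gen_size n x. x (Suc n, i)) \<in> PiM K (\<lambda>_. count_space UNIV) \<rightarrow>\<^sub>M count_space (UNIV :: nat set)"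
    by (rule measurable_compose_countable) measurable
  then show ?case
    by simp
qed

text \<open>Only rows 1 to \<open>n\<close> of the array are read. This puts \<open>Z n\<close> on a
  block disjoint from row \<open>n + 1\<close>.\<close>

lemma Z_eq_gen_size:
  assumes "w \<in> space M"
  shows "Z n w = gen_size n (restrict (\<lambda>(m, i). X m i w) ({1..n} \<times> {1..}))"
proof -
  have "Z m w = gen_size m (restrict (\<lambda>(m, i). X m i w) ({1..n} \<times> {1..}))" if "m \<le> n" for m
    using that by (induction m) (auto simp: Z_0 Z_Suc assms)
  then show ?thesis
    by simp
qed

section \<open>Generating function of the generation sizes\<close>

lemma measurable_Z [measurable]: "Z n \<in> M \<rightarrow>\<^sub>M count_space UNIV"
proof (induction n)
  case 0
  then show ?case
    by (subst measurable_cong[where g="\<lambda>_. 1"]) (auto simp: Z_0)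
next
  case (Suc n)
  have "(\<lambda>w. \<Sum>i=1..k. X (Suc n) i w) \<in> M \<rightarrow>\<^sub>M count_space UNIV" for k
    by measurable
  from measurable_compose_countable[OF this Suc]
  show ?case
    by (subst measurable_cong[where g="\<lambda>w. \<Sum>i=1..Z n w. X (Suc n) i w"]) (auto simp: Z_Suc)
qed

text \<open>On \<open>Z n = k\<close> the next generation is a sum of \<open>k\<close> offspring
  numbers, and the event itself is determined by earlier rows. The integrand is thus a product of
  \<open>k + 1\<close> independent factors.\<close>

lemma nn_integral_Z_Suc_slice:
  assumes s: "0 \<le> s" "s \<le> 1"
  shows "(\<integral>\<^sup>+w. ennreal (s ^ Z (Suc n) w) * indicator {w. Z n w = k} w \<partial>M) =
    ennreal (theta_pgf \<theta> (a (Suc n)) (c (Suc n)) s) ^ k * ennreal (prob {w \<in> space M. Z n w = k})"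
proof -
  \<comment> \<open>Block 0 holds the whole past, block \<open>j \<ge> 1\<close> the one variable of
    individual \<open>j\<close>; individuals are numbered from 1, which leaves 0 free.\<close>
  define K where "K = (\<lambda>j::nat. if j = 0 then {1..n} \<times> {1::nat..} else {(Suc n, j)})"
  define g where "g = (\<lambda>j x. if j = 0 then indicator {x. gen_size n x = k} x
    else ennreal (s ^ x (Suc n, j)))"
  define Y where "Y = (\<lambda>j w. g j (restrict (\<lambda>(m, i). X m i w) (K j)))"
  have ind: "indep_vars (\<lambda>j. PiM (K j) (\<lambda>_. count_space UNIV))
      (\<lambda>j w. restrict (\<lambda>i. (case i of (m, i) \<Rightarrow> X m i) w) (K j)) {0..k}"
    by (rule indep_vars_restrict[OF offspring_indep])
      (auto simp: K_def disjoint_family_on_def)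
  have "(\<lambda>j w. restrict (\<lambda>i. (case i of (m, i) \<Rightarrow> X m i) w) (K j))
      = (\<lambda>j w. restrict (\<lambda>(m, i). X m i w) (K j))"
    by (intro ext) (auto simp: restrict_def)
  note ind = ind[unfolded this]
  have [measurable]: "gen_size n \<in> PiM (K 0) (\<lambda>_. count_space UNIV) \<rightarrow>\<^sub>M count_space UNIV"
    by (rule measurable_gen_size) (simp add: K_def)
  have "g 0 = indicator {x. gen_size n x = k}"
    by (simp add: g_def fun_eq_iff)
  then have "g 0 \<in> borel_measurable (PiM (K 0) (\<lambda>_. count_space UNIV))"
    by simp
  moreover have "g j \<in> borel_measurable (PiM (K j) (\<lambda>_. count_space UNIV))" if "j \<noteq> 0" for j
  proof -
    have [measurable]: "(\<lambda>x. x (Suc n, j)) \<in> PiM (K j) (\<lambda>_. count_space UNIV) \<rightarrow>\<^sub>M count_space UNIV"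
      using that by (intro measurable_component_singleton) (auto simp: K_def)
    show ?thesis
      using that unfolding g_def by simp
  qed
  ultimately have "g j \<in> borel_measurable (PiM (K j) (\<lambda>_. count_space UNIV))" for j
    by (cases "j = 0") auto
  then have indY: "indep_vars (\<lambda>_. borel) Y {0..k}"
    unfolding Y_def by (intro indep_vars_compose2[OF ind]) auto
  have Y0: "Y 0 w = indicator {w. Z n w = k} w" if "w \<in> space M" for w
    using Z_eq_gen_size[OF that, of n] by (simp add: Y_def g_def K_def indicator_def)
  have YS: "Y j w = ennreal (s ^ X (Suc n) j w)" if "j \<noteq> 0" for j w
    using that by (simp add: Y_def g_def K_def)
  have "(\<integral>\<^sup>+w. ennreal (s ^ Z (Suc n) w) * indicator {w. Z n w = k} w \<partial>M) = (\<integral>\<^sup>+w. (\<Prod>j\<in>{0..k}. Y j w) \<partial>M)"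
  proof (rule nn_integral_cong)
    fix w assume w: "w \<in> space M"
    have "(\<Prod>j\<in>{0..k}. Y j w) = Y 0 w * (\<Prod>j=1..k. ennreal (s ^ X (Suc n) j w))"
      by (subst prod.atLeast_Suc_atMost) (auto simp: YS)
    also have "\<dots> = Y 0 w * ennreal (s ^ (\<Sum>i=1..k. X (Suc n) i w))"
      using s by (simp add: prod_ennreal power_sum)
    also have "\<dots> = ennreal (s ^ Z (Suc n) w) * indicator {w. Z n w = k} w"
      using w by (auto simp: Y0 Z_Suc indicator_def)
    finally show "ennreal (s ^ Z (Suc n) w) * indicator {w. Z n w = k} w = (\<Prod>j\<in>{0..k}. Y j w)" ..
  qed
  also have "\<dots> = (\<Prod>j\<in>{0..k}. \<integral>\<^sup>+w. Y j w \<partial>M)"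
    by (rule indep_vars_nn_integral[OF _ indY]) auto
  also have "\<dots> = (\<integral>\<^sup>+w. Y 0 w \<partial>M) * (\<Prod>j=1..k. \<integral>\<^sup>+w. Y j w \<partial>M)"
    by (subst prod.atLeast_Suc_atMost) auto
  also have "(\<integral>\<^sup>+w. Y 0 w \<partial>M) = (\<integral>\<^sup>+w. indicator {w \<in> space M. Z n w = k} w \<partial>M)"
    by (intro nn_integral_cong) (auto simp: Y0 indicator_def)
  also have "\<dots> = ennreal (prob {w \<in> space M. Z n w = k})"
    by (subst nn_integral_indicator) (auto simp: emeasure_eq_measure)
  also have "(\<Prod>j=1..k. \<integral>\<^sup>+w. Y j w \<partial>M)
      = (\<Prod>j=1..k. ennreal (theta_pgf \<theta> (a (Suc n)) (c (Suc n)) s))"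
    by (intro prod.cong refl) (auto simp: YS nn_integral_offspring s)
  finally show ?thesis
    by (simp add: mult.commute)
qed

lemma a_add_c_ge_1: "n \<ge> 1 \<Longrightarrow> 1 \<le> a n + c n"
  using c_ge[of n] by simp

lemma theta_pgf_bounds:
  assumes "n \<ge> 1" "0 \<le> s" "s \<le> 1"
  shows "0 \<le> theta_pgf \<theta> (a n) (c n) s" "theta_pgf \<theta> (a n) (c n) s \<le> 1"
  using assms theta_map_le_1[OF theta_pos less_imp_le[OF a_pos] a_add_c_ge_1, of n "1 - s"]
  by (auto simp: theta_pgf_def)

lemma integrable_power_Z:
  fixes s :: real
  assumes "0 \<le> s" "s \<le> 1"
  shows "integrable M (\<lambda>w. s ^ Z n w)"
  using assms by (intro integrable_const_bound[where B=1]) (auto intro: power_le_one)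

text \<open>Summing the slices over \<open>k\<close> peels off the innermost function of the
  composition.\<close>

lemma expectation_power_Z_Suc:
  assumes s: "0 \<le> s" "s \<le> 1"
  shows "expectation (\<lambda>w. s ^ Z (Suc n) w)
    = expectation (\<lambda>w. theta_pgf \<theta> (a (Suc n)) (c (Suc n)) s ^ Z n w)"
proof -
  let ?f = "theta_pgf \<theta> (a (Suc n)) (c (Suc n)) s"
  have "(\<integral>\<^sup>+w. ennreal (s ^ Z (Suc n) w) \<partial>M)
      = (\<Sum>k. ennreal ?f ^ k * ennreal (prob {w \<in> space M. Z n w = k}))"
    by (subst nn_integral_nat_split[of "Z n"]) (auto simp: nn_integral_Z_Suc_slice s)
  also have "\<dots> = (\<integral>\<^sup>+w. ennreal ?f ^ Z n w \<partial>M)"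
    by (rule nn_integral_nat_fun[symmetric]) measurable
  also have "\<dots> = (\<integral>\<^sup>+w. ennreal (?f ^ Z n w) \<partial>M)"
    using theta_pgf_bounds[of "Suc n" s] s by (simp add: ennreal_power)
  finally show ?thesis
    using s theta_pgf_bounds[of "Suc n" s] by (simp add: integral_eq_nn_integral)
qed

lemma env_A_pos: "0 < env_A a n"
  unfolding env_A_def by (intro prod_pos) (auto intro: a_pos)

lemma env_C_nonneg: "0 \<le> env_C a c n"
  unfolding env_C_def by (intro sum_nonneg mult_nonneg_nonneg) (auto simp: less_imp_le c_pos env_A_pos)

text \<open>The induction hypothesis is needed at
  \<open>theta_pgf \<theta> (a (Suc n)) (c (Suc n)) s\<close>, hence the generalisation over
  \<open>s\<close>. At time 0 the coefficients 1 and 0 give the identity map.\<close>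

lemma expectation_power_Z:
  assumes "0 \<le> s" "s \<le> 1"
  shows "expectation (\<lambda>w. s ^ Z n w) = 1 - theta_map \<theta> (env_A a n) (env_C a c n) (1 - s)"
  using assms
proof (induction n arbitrary: s)
  case 0
  have "expectation (\<lambda>w. s ^ Z 0 w) = expectation (\<lambda>w. s)"
    by (intro Bochner_Integration.integral_cong) (auto simp: Z_0)
  then show ?case
    using 0 theta_pos by (auto simp: theta_map_def powr_powr prob_space)
next
  case (Suc n)
  have "expectation (\<lambda>w. s ^ Z (Suc n) w)
      = 1 - theta_map \<theta> (env_A a n) (env_C a c n) (theta_map \<theta> (a (Suc n)) (c (Suc n)) (1 - s))"
    using Suc theta_pgf_bounds[of "Suc n" s]
    by (simp add: expectation_power_Z_Suc) (simp add: theta_pgf_def)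
  then show ?case
    using Suc.prems theta_pos env_A_pos[of n] a_pos[of "Suc n"] c_pos[of "Suc n"]
    by (simp add: theta_map_comp env_A_Suc env_C_Suc)
qed

section \<open>Extinction probability, survival probability and mean at a fixed time\<close>

lemma prob_Z_eq_0: "prob {w \<in> space M. Z n w = 0} = 1 - (env_A a n + env_C a c n) powr (-1/\<theta>)"
proof -
  have "prob {w \<in> space M. Z n w = 0} = expectation (indicator {w \<in> space M. Z n w = 0})"
    by simp
  \<comment> \<open>Since \<open>0 ^ 0 = 1\<close>, the variable \<open>0 ^ Z n w\<close> is the
    indicator of extinction.\<close>
  also have "\<dots> = expectation (\<lambda>w. 0 ^ Z n w)"
    by (intro Bochner_Integration.integral_cong) (auto simp: indicator_def)
  finally show ?thesis
    using expectation_power_Z[of 0 n] by (simp add: theta_map_def)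
qed

lemma prob_Z_pos: "prob {w \<in> space M. 0 < Z n w} = (env_A a n + env_C a c n) powr (-1/\<theta>)"
proof -
  have "prob {w \<in> space M. 0 < Z n w} = 1 - prob {w \<in> space M. Z n w = 0}"
    by (subst prob_neg[symmetric]) auto
  then show ?thesis
    by (simp add: prob_Z_eq_0)
qed

text \<open>The mean is the limit of the difference quotients of the generating function at 1, by
  monotone convergence of the geometric sums to their number of terms.\<close>

lemma expectation_Z: "integrable M (\<lambda>w. real (Z n w))"
  "expectation (\<lambda>w. real (Z n w)) = env_A a n powr (-1/\<theta>)"
proof -
  \<comment> \<open>The points \<open>s m\<close> increase to 1 and stay below it, so
    \<open>F'\<close> never divides by zero.\<close>
  define s where "s = (\<lambda>m. 1 - 1 / real (Suc m))"
  define F where "F = (\<lambda>m w. \<Sum>j<Z n w. s m ^ j)"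
  have s: "0 \<le> s m" "s m < 1" for m
    by (auto simp: s_def)
  have F: "F m w = (1 - s m ^ Z n w) / (1 - s m)" for m w
    using s[of m] by (simp add: F_def sum_gp_strict)
  have F': "F m = (\<lambda>w. (1 - s m ^ Z n w) / (1 - s m))" for m
    by (simp add: F fun_eq_iff)
  have mono_s: "mono s"
    unfolding s_def by (auto intro!: monoI simp: divide_simps algebra_simps)
  have s_lim: "s \<longlonglongrightarrow> 1"
    unfolding s_def using tendsto_diff[OF tendsto_const[of 1] LIMSEQ_inverse_real_of_nat]
    by (simp add: inverse_eq_divide)
  have int: "integrable M (F m)" for m
    unfolding F' using s[of m] less_imp_le[OF s(2)]
    by (intro integrable_divide Bochner_Integration.integrable_diff integrable_power_Z) auto
  have F_int: "expectation (F m) = (env_A a n + env_C a c n * (1 - s m) powr \<theta>) powr (-1/\<theta>)" for m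
  proof -
    let ?x = "1 - s m"
    have x: "0 < ?x"
      using s[of m] by simp
    have "expectation (F m) = theta_map \<theta> (env_A a n) (env_C a c n) ?x / ?x"
      unfolding F' using s[of m] less_imp_le[OF s(2)]
      by (simp add: integrable_power_Z expectation_power_Z prob_space)
    \<comment> \<open>With the divisor written as a power of exponent -1/\<theta>, the division
      moves inside the outer power. Only the \<open>env_C\<close> term then depends on
      \<open>m\<close>, and it vanishes in the limit.\<close>
    also have "\<dots> = (env_A a n * ?x powr (-\<theta>) + env_C a c n) powr (-1/\<theta>) / (?x powr (-\<theta>)) powr (-1/\<theta>)"
      using x theta_pos by (simp add: theta_map_def powr_powr)
    also have "\<dots> = ((env_A a n * ?x powr (-\<theta>) + env_C a c n) / ?x powr (-\<theta>)) powr (-1/\<theta>)"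
      using env_A_pos[of n] env_C_nonneg[of n] by (subst powr_divide) auto
    also have "(env_A a n * ?x powr (-\<theta>) + env_C a c n) / ?x powr (-\<theta>) = env_A a n + env_C a c n * ?x powr \<theta>"
      using x by (simp add: powr_minus field_simps)
    finally show ?thesis .
  qed
  have "(\<lambda>m. (1 - s m) powr \<theta>) \<longlonglongrightarrow> 0"
    using s_lim theta_pos
    by (intro tendsto_zero_powrI[where b=\<theta>]) (auto intro!: tendsto_eq_intros simp: less_imp_le[OF s(2)])
  then have "(\<lambda>m. (env_A a n + env_C a c n * (1 - s m) powr \<theta>) powr (-1/\<theta>))
      \<longlonglongrightarrow> (env_A a n + env_C a c n * 0) powr (-1/\<theta>)"
    using env_A_pos[of n] by (intro tendsto_powr tendsto_add tendsto_mult tendsto_const) auto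
  then have F_lim: "(\<lambda>m. expectation (F m)) \<longlonglongrightarrow> env_A a n powr (-1/\<theta>)"
    by (simp add: F_int)
  have "AE w in M. mono (\<lambda>m. F m w)"
    using monoD[OF mono_s] s
    by (auto intro!: AE_I2 monoI sum_mono power_mono simp: F_def)
  moreover have "AE w in M. (\<lambda>m. F m w) \<longlonglongrightarrow> real (Z n w)"
    unfolding F_def using s_lim by (auto intro!: AE_I2 tendsto_eq_intros)
  ultimately show "integrable M (\<lambda>w. real (Z n w))"
    "expectation (\<lambda>w. real (Z n w)) = env_A a n powr (-1/\<theta>)"
    using integrable_monotone_convergence[OF int _ _ F_lim, of "\<lambda>w. real (Z n w)"]
      integral_monotone_convergence[OF int _ _ F_lim, of "\<lambda>w. real (Z n w)"] by auto
qed

section \<open>The law conditioned on survival at a fixed time\<close>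

lemma env_AC_pos: "0 < env_A a n + env_C a c n"
  using env_A_pos[of n] env_C_nonneg[of n] by linarith

lemma prob_Z_pos_pos: "0 < prob {w \<in> space M. 0 < Z n w}"
  using env_AC_pos[of n] by (simp add: prob_Z_pos)

lemma env_B_nonneg: "0 \<le> env_B a c n"
  using env_A_pos[of n] env_C_nonneg[of n] by (simp add: env_B_def)

lemma env_AC_eq: "env_A a n + env_C a c n = env_A a n * (1 + env_B a c n)"
  using env_A_pos[of n] by (simp add: env_B_def field_simps)

text \<open>Mean and survival probability are the powers of exponent -1/\<theta> of
  \<open>env_A\<close> and of \<open>env_A * (1 + env_B)\<close>; \<open>env_A\<close> cancels in
  their quotient.\<close>

lemma cond_mean_Z:
  "cond_expect M (\<lambda>w. real (Z n w)) (\<lambda>w. 0 < Z n w) = (1 + env_B a c n) powr (1/\<theta>)"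
proof -
  have "cond_expect M (\<lambda>w. real (Z n w)) (\<lambda>w. 0 < Z n w)
      = expectation (\<lambda>w. real (Z n w) * indicator {w. 0 < Z n w} w) / prob {w \<in> space M. 0 < Z n w}"
    by (intro cond_expect_eq prob_Z_pos_pos) measurable
  also have "expectation (\<lambda>w. real (Z n w) * indicator {w. 0 < Z n w} w) = env_A a n powr (-1/\<theta>)"
    by (subst expectation_Z(2)[symmetric], intro Bochner_Integration.integral_cong)
      (auto simp: indicator_def)
  finally show ?thesis
    using env_A_pos[of n] env_B_nonneg[of n]
    by (simp add: prob_Z_pos env_AC_eq powr_mult powr_minus divide_inverse)
qed

text \<open>Before passing to the limit, the conditional law is already the limit law with
  \<^term>\<open>env_B a c n\<close> in place of \<open>b\<close>.\<close>

lemma cond_pgf_Z: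
  assumes s: "0 \<le> s" "s \<le> 1"
  shows "cond_expect M (\<lambda>w. s ^ Z n w) (\<lambda>w. 0 < Z n w) = cond_limit_pgf \<theta> (env_B a c n) s"
proof -
  let ?P = "prob {w \<in> space M. 0 < Z n w}"
  have "cond_expect M (\<lambda>w. s ^ Z n w) (\<lambda>w. 0 < Z n w)
      = expectation (\<lambda>w. s ^ Z n w * indicator {w. 0 < Z n w} w) / ?P"
    by (intro cond_expect_eq prob_Z_pos_pos) measurable
  \<comment> \<open>Where \<open>Z n w = 0\<close> both \<open>s ^ Z n w\<close> and
    \<open>0 ^ Z n w\<close> are 1, even for \<open>s = 0\<close>; elsewhere the second is
    0.\<close>
  also have "expectation (\<lambda>w. s ^ Z n w * indicator {w. 0 < Z n w} w)
      = expectation (\<lambda>w. s ^ Z n w - 0 ^ Z n w)"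
    by (intro Bochner_Integration.integral_cong) (auto simp: indicator_def)
  also have "\<dots> = ?P - theta_map \<theta> (env_A a n) (env_C a c n) (1 - s)"
    using s integrable_power_Z[of 0 n]
    by (simp add: integrable_power_Z expectation_power_Z prob_Z_pos del: power_0_left)
      (simp add: theta_map_def)
  also have "(\<dots>) / ?P = 1 - theta_map \<theta> (env_A a n) (env_C a c n) (1 - s) / ?P"
    using prob_Z_pos_pos[of n] by (simp add: diff_divide_distrib)
  also have "\<dots> = cond_limit_pgf \<theta> (env_B a c n) s"
    unfolding prob_Z_pos cond_limit_pgf_def env_B_def
    using s env_A_pos[of n] env_C_nonneg[of n] by (subst theta_map_divide) auto
  finally show ?thesis .
qed

section \<open>Divergence of \<open>env_A + env_C\<close> and almost sure extinction\<close>

lemma incseq_env_C: "incseq (env_C a c)"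
  using env_A_pos c_pos by (intro incseq_SucI) (simp add: env_C_Suc less_imp_le)

text \<open>The increment is \<open>env_A a n * (a (Suc n) + c (Suc n) - 1)\<close>, nonnegative by
  \<open>c_ge\<close>.\<close>

lemma incseq_env_AC: "incseq (\<lambda>n. env_A a n + env_C a c n)"
proof (rule incseq_SucI)
  fix n
  have "env_A a n * 1 \<le> env_A a n * (a (Suc n) + c (Suc n))"
    using env_A_pos[of n] a_add_c_ge_1[of "Suc n"] by (intro mult_left_mono) auto
  then show "env_A a n + env_C a c n \<le> env_A a (Suc n) + env_C a c (Suc n)"
    by (simp add: env_A_Suc env_C_Suc distrib_left)
qed

lemma env_AC_at_top:
  assumes "\<nexists>L::ereal. (\<lambda>n. ereal (env_B a c n)) \<longlonglongrightarrow> L"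
  shows "filterlim (\<lambda>n. env_A a n + env_C a c n) at_top sequentially"
  unfolding filterlim_at_top
proof
  fix K
  show "eventually (\<lambda>n. K \<le> env_A a n + env_C a c n) sequentially"
  proof (cases "\<exists>N. K \<le> env_A a N + env_C a c N")
    case True
    then obtain N where "K \<le> env_A a N + env_C a c N" ..
    then show ?thesis
      using incseqD[OF incseq_env_AC, of N] unfolding eventually_sequentially
      by (intro exI[of _ N]) (auto intro: order_trans)
  next
    case False
    then have AC_bd: "env_A a n + env_C a c n \<le> K" for n
      by (metis linear)
    have C_bd: "env_C a c n \<le> K" for n
      using AC_bd[of n] env_A_pos[of n] by linarith
    obtain L where L: "(\<lambda>n. env_A a n + env_C a c n) \<longlonglongrightarrow> L"
      using incseq_convergent[OF incseq_env_AC] AC_bd by metis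
    obtain L' where L': "env_C a c \<longlonglongrightarrow> L'" "\<And>n. env_C a c n \<le> L'"
      using incseq_convergent[OF incseq_env_C] C_bd by metis
    \<comment> \<open>A positive limit of \<open>env_C\<close> is what drives \<open>env_B\<close>
      to infinity if \<open>env_A\<close> tends to 0.\<close>
    have "0 < env_C a c 1"
      using c_pos[of 1] by (simp add: env_C_def)
    then have L'_pos: "0 < L'"
      using L'(2)[of 1] by linarith
    have A: "env_A a \<longlonglongrightarrow> L - L'"
      using tendsto_diff[OF L L'(1)] by simp
    have "\<exists>l. (\<lambda>n. ereal (env_B a c n)) \<longlonglongrightarrow> l"
    \<comment> \<open>Either limit of \<open>env_A\<close> contradicts the assumption: 0 sends
      \<open>env_B\<close> to infinity, any other value makes it converge to a real number.\<close>
    proof (cases "L - L' = 0")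
      case True
      then have "filterlim (env_A a) (at_right 0) sequentially"
        using A env_A_pos by (simp add: filterlim_at less_imp_neq[symmetric])
      then have "filterlim (env_B a c) at_top sequentially"
        unfolding env_B_def divide_inverse
        by (intro filterlim_tendsto_pos_mult_at_top[OF L'(1) L'_pos]
            filterlim_compose[OF filterlim_inverse_at_top_right])
      then show ?thesis
        by (intro exI[of _ \<infinity>]) (simp add: tendsto_PInfty_eq_at_top)
    next
      case False
      then have "env_B a c \<longlonglongrightarrow> L' / (L - L')"
        unfolding env_B_def by (intro tendsto_divide L' A)
      then show ?thesis
        by (intro exI) (rule tendsto_ereal)
    qed
    with assms show ?thesis
      by simp
  qed
qed

lemma extinction_prob_eq_1:
  assumes "filterlim (\<lambda>n. env_A a n + env_C a c n) at_top sequentially"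
  shows "extinction_prob M Z = 1"
proof -
  have "(\<lambda>n. (env_A a n + env_C a c n) powr (-1/\<theta>)) \<longlonglongrightarrow> 0"
    using theta_pos by (intro tendsto_neg_powr[OF _ assms]) simp
  from tendsto_diff[OF tendsto_const[of 1] this]
  have "(\<lambda>n. 1 - (env_A a n + env_C a c n) powr (-1/\<theta>)) \<longlonglongrightarrow> 1"
    by simp
  then show ?thesis
    unfolding extinction_prob_def prob_Z_eq_0 by (rule limI)
qed

section \<open>Times along which \<open>env_B\<close> has a finite limit\<close>

lemma env_A_at_top:
  assumes AC: "filterlim (\<lambda>n. env_A a (k n) + env_C a c (k n)) at_top F"
    and B: "((\<lambda>n. env_B a c (k n)) \<longlongrightarrow> b) F" and b: "0 \<le> b"
  shows "filterlim (\<lambda>n. env_A a (k n)) at_top F"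
proof -
  \<comment> \<open>\<open>env_A\<close> is \<open>env_A + env_C\<close> divided by
    \<open>1 + env_B\<close>, and the divisor has a finite positive limit.\<close>
  have "((\<lambda>n. inverse (1 + env_B a c (k n))) \<longlongrightarrow> inverse (1 + b)) F"
    using b by (intro tendsto_intros B) auto
  then have "filterlim (\<lambda>n. inverse (1 + env_B a c (k n)) * (env_A a (k n) + env_C a c (k n))) at_top F"
    by (rule filterlim_tendsto_pos_mult_at_top[OF _ _ AC]) (use b in auto)
  moreover have "1 + env_B a c m \<noteq> 0" for m
    using env_B_nonneg[of m] by linarith
  then have "inverse (1 + env_B a c m) * (env_A a m + env_C a c m) = env_A a m" for m
    by (simp add: env_AC_eq)
  ultimately show ?thesis
    by simp
qed

text \<open>By \<open>env_AC_eq\<close> the factor \<open>env_A\<close> cancels exactly, leaving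
  \<open>(1 + env_B) powr (-1/\<theta>)\<close> over its limit.\<close>

lemma survival_asymp_finite:
  assumes B: "((\<lambda>n. env_B a c (k n)) \<longlongrightarrow> b) F" and b: "0 \<le> b"
  shows "(\<lambda>n. prob {w \<in> space M. 0 < Z (k n) w}) \<sim>[F]
    (\<lambda>n. (1 + b) powr (-1/\<theta>) * env_A a (k n) powr (-1/\<theta>))"
proof (rule asymp_equivI')
  have "((\<lambda>n. (1 + env_B a c (k n)) powr (-1/\<theta>) / (1 + b) powr (-1/\<theta>)) \<longlongrightarrow>
      (1 + b) powr (-1/\<theta>) / (1 + b) powr (-1/\<theta>)) F"
    using b by (intro tendsto_intros B) auto
  moreover have "prob {w \<in> space M. 0 < Z m w} / ((1 + b) powr (-1/\<theta>) * env_A a m powr (-1/\<theta>))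
      = (1 + env_B a c m) powr (-1/\<theta>) / (1 + b) powr (-1/\<theta>)" for m
    using env_A_pos[of m] env_B_nonneg[of m] by (simp add: prob_Z_pos env_AC_eq powr_mult)
  ultimately show "((\<lambda>n. prob {w \<in> space M. 0 < Z (k n) w} /
      ((1 + b) powr (-1/\<theta>) * env_A a (k n) powr (-1/\<theta>))) \<longlongrightarrow> 1) F"
    using b by simp
qed

lemma cond_mean_tendsto:
  assumes B: "((\<lambda>n. env_B a c (k n)) \<longlongrightarrow> b) F" and b: "0 \<le> b"
  shows "((\<lambda>n. cond_expect M (\<lambda>w. real (Z (k n) w)) (\<lambda>w. 0 < Z (k n) w)) \<longlongrightarrow>
    (1 + b) powr (1/\<theta>)) F"
  unfolding cond_mean_Z using b by (intro tendsto_intros B) auto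

lemma cond_pgf_tendsto:
  assumes B: "((\<lambda>n. env_B a c (k n)) \<longlongrightarrow> b) F" and b: "0 \<le> b"
    and s: "0 \<le> s" "s \<le> 1"
  shows "((\<lambda>n. cond_expect M (\<lambda>w. s ^ Z (k n) w) (\<lambda>w. 0 < Z (k n) w)) \<longlongrightarrow> cond_limit_pgf \<theta> b s) F"
proof -
  have "((\<lambda>n. cond_limit_pgf \<theta> (env_B a c (k n)) s) \<longlongrightarrow> cond_limit_pgf \<theta> b s) F"
  \<comment> \<open>At \<open>s = 1\<close> both sides are 1 through the branch of
    \<open>theta_map\<close> at 0; otherwise the formula is continuous in \<open>b\<close>.\<close>
  proof (cases "s = 1")
    case False
    then have "0 < (1 - s) powr (-\<theta>)"
      using s by simp
    then have "0 < 1 / (1 + b) * (1 - s) powr (-\<theta>) + b / (1 + b)"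
      using b by (intro add_pos_nonneg mult_pos_pos) auto
    then have "((\<lambda>n. 1 - (1 / (1 + env_B a c (k n)) * (1 - s) powr (-\<theta>)
          + env_B a c (k n) / (1 + env_B a c (k n))) powr (-1/\<theta>)) \<longlongrightarrow>
        1 - (1 / (1 + b) * (1 - s) powr (-\<theta>) + b / (1 + b)) powr (-1/\<theta>)) F"
      using b by (intro tendsto_intros B) auto
    then show ?thesis
      using False by (simp add: cond_limit_pgf_def theta_map_def)
  qed (simp add: cond_limit_pgf_def)
  then show ?thesis
    by (simp add: cond_pgf_Z[OF s])
qed

section \<open>Times along which \<open>env_B\<close> tends to infinity\<close>

lemma survival_asymp_infinite:
  assumes B: "filterlim (\<lambda>n. env_B a c (k n)) at_top F"
  shows "(\<lambda>n. prob {w \<in> space M. 0 < Z (k n) w}) \<sim>[F] (\<lambda>n. env_C a c (k n) powr (-1/\<theta>))"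
proof (rule asymp_equivI')
  \<comment> \<open>The quotient is a power of
    \<open>(env_A + env_C) / env_C = 1 + 1 / env_B\<close>.\<close>
  have "((\<lambda>n. (1 + 1 / env_B a c (k n)) powr (-1/\<theta>)) \<longlongrightarrow> (1 + 0) powr (-1/\<theta>)) F"
    by (intro tendsto_intros tendsto_divide_0[OF tendsto_const] filterlim_at_top_imp_at_infinity B) auto
  moreover have "eventually (\<lambda>n. (1 + 1 / env_B a c (k n)) powr (-1/\<theta>)
      = prob {w \<in> space M. 0 < Z (k n) w} / env_C a c (k n) powr (-1/\<theta>)) F"
    \<comment> \<open>The identity needs \<open>env_C > 0\<close>, which fails at time 0 but holds
      wherever \<open>env_B > 0\<close>.\<close>
    using filterlim_at_top_dense[THEN iffD1, OF B, rule_format, of 0]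
  proof eventually_elim
    case (elim n)
    then have "0 < env_C a c (k n)"
      using env_A_pos[of "k n"] by (simp add: env_B_def zero_less_divide_iff)
    then have "1 + 1 / env_B a c (k n) = (env_A a (k n) + env_C a c (k n)) / env_C a c (k n)"
      using env_A_pos[of "k n"] by (simp add: env_B_def field_simps)
    then show ?case
      using env_AC_pos[of "k n"] env_C_nonneg[of "k n"] by (simp add: prob_Z_pos powr_divide)
  qed
  ultimately have "((\<lambda>n. prob {w \<in> space M. 0 < Z (k n) w} / env_C a c (k n) powr (-1/\<theta>)) \<longlongrightarrow>
      (1 + 0) powr (-1/\<theta>)) F"
    by (rule Lim_transform_eventually)
  then show "((\<lambda>n. prob {w \<in> space M. 0 < Z (k n) w} / env_C a c (k n) powr (-1/\<theta>)) \<longlongrightarrow> 1) F"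
    by simp
qed

lemma cond_mean_asymp:
  assumes B: "filterlim (\<lambda>n. env_B a c (k n)) at_top F"
  shows "(\<lambda>n. cond_expect M (\<lambda>w. real (Z (k n) w)) (\<lambda>w. 0 < Z (k n) w)) \<sim>[F]
    (\<lambda>n. env_B a c (k n) powr (1/\<theta>))"
proof (rule asymp_equivI')
  have "((\<lambda>n. (1 + 1 / env_B a c (k n)) powr (1/\<theta>)) \<longlongrightarrow> (1 + 0) powr (1/\<theta>)) F"
    by (intro tendsto_intros tendsto_divide_0[OF tendsto_const] filterlim_at_top_imp_at_infinity B) auto
  moreover have "eventually (\<lambda>n. (1 + 1 / env_B a c (k n)) powr (1/\<theta>)
      = (1 + env_B a c (k n)) powr (1/\<theta>) / env_B a c (k n) powr (1/\<theta>)) F"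
    using filterlim_at_top_dense[THEN iffD1, OF B, rule_format, of 0]
  proof eventually_elim
    case (elim n)
    then have "1 + 1 / env_B a c (k n) = (1 + env_B a c (k n)) / env_B a c (k n)"
      by (simp add: field_simps)
    then show ?case
      using elim by (simp add: powr_divide)
  qed
  ultimately have "((\<lambda>n. (1 + env_B a c (k n)) powr (1/\<theta>) / env_B a c (k n) powr (1/\<theta>)) \<longlongrightarrow>
      (1 + 0) powr (1/\<theta>)) F"
    by (rule Lim_transform_eventually)
  then show "((\<lambda>n. cond_expect M (\<lambda>w. real (Z (k n) w)) (\<lambda>w. 0 < Z (k n) w) /
      env_B a c (k n) powr (1/\<theta>)) \<longlongrightarrow> 1) F"
    by (simp add: cond_mean_Z)
qed

text \<open>The transform is the conditional generating function at
  \<open>s = exp (- (u * h n))\<close>. For \<open>u > 0\<close>, \<open>1 - s\<close> behaves like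
  \<open>u * h n\<close>, so \<open>(1 - s) powr (-\<theta>)\<close> behaves like
  \<open>u powr (-\<theta>) * env_B\<close>, and the weights 1 / (1 + \<open>env_B\<close>) and
  \<open>env_B\<close> / (1 + \<open>env_B\<close>) lead to the base
  \<open>u powr (-\<theta>) + 1\<close>.\<close>

lemma cond_laplace_tendsto:
  assumes B: "filterlim (\<lambda>n. env_B a c (k n)) at_top F" and u: "0 \<le> u"
  shows "((\<lambda>n. cond_expect M (\<lambda>w. exp (- (u * env_B a c (k n) powr (-1/\<theta>)) * real (Z (k n) w)))
      (\<lambda>w. 0 < Z (k n) w)) \<longlongrightarrow> 1 - theta_map \<theta> 1 1 u) F"
proof -
  define h where "h = (\<lambda>n. env_B a c (k n) powr (-1/\<theta>))"
  define x where "x = (\<lambda>n. 1 - exp (- (u * h n)))"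
  have "exp (- (u * h n) * real m) = exp (- (u * h n)) ^ m" for n m
    by (simp add: exp_of_nat_mult[symmetric] mult.commute)
  moreover have "exp (- (u * h n)) \<le> 1" for n
    using u by (simp add: h_def)
  ultimately have eq: "cond_expect M (\<lambda>w. exp (- (u * h n) * real (Z (k n) w))) (\<lambda>w. 0 < Z (k n) w)
      = cond_limit_pgf \<theta> (env_B a c (k n)) (exp (- (u * h n)))" for n
    by (simp add: cond_pgf_Z)
  have "((\<lambda>n. cond_limit_pgf \<theta> (env_B a c (k n)) (exp (- (u * h n)))) \<longlongrightarrow> 1 - theta_map \<theta> 1 1 u) F"
  proof (cases "u = 0")
    case False
    with u have u: "0 < u"
      by simp
    have B_pos: "eventually (\<lambda>n. 0 < env_B a c (k n)) F"
      using filterlim_at_top_dense[THEN iffD1, OF B] by blast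
    have "(h \<longlongrightarrow> 0) F"
      unfolding h_def using theta_pos by (intro tendsto_neg_powr[OF _ B]) simp
    moreover have "eventually (\<lambda>n. h n \<noteq> 0) F"
      using B_pos by eventually_elim (simp add: h_def)
    ultimately have h: "filterlim h (at 0) F"
      by (simp add: filterlim_at)
    \<comment> \<open>The difference quotient at 0 gives the limit \<open>u\<close> of
      \<open>x n / h n\<close>; it is composed with \<open>h\<close>, which is eventually
      nonzero.\<close>
    have "((\<lambda>y. 1 - exp (- (u * y))) has_field_derivative u) (at 0)"
      by (auto intro!: derivative_eq_intros)
    then have "((\<lambda>y. (1 - exp (- (u * y))) / y) \<longlongrightarrow> u) (at 0)"
      by (simp add: has_field_derivative_iff)
    from filterlim_compose[OF this h] have x: "((\<lambda>n. x n / h n) \<longlongrightarrow> u) F"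
      by (simp add: x_def)
    have B': "((\<lambda>n. 1 - 1 / (1 + env_B a c (k n))) \<longlongrightarrow> 1 - 0) F"
      by (intro tendsto_intros tendsto_divide_0[OF tendsto_const] filterlim_at_top_imp_at_infinity
          filterlim_tendsto_add_at_top[OF tendsto_const B])
    have "((\<lambda>n. 1 - ((1 - 1 / (1 + env_B a c (k n))) * ((x n / h n) powr (-\<theta>) + 1)) powr (-1/\<theta>)) \<longlongrightarrow>
        1 - ((1 - 0) * (u powr (-\<theta>) + 1)) powr (-1/\<theta>)) F"
      using u by (intro B' tendsto_diff tendsto_mult tendsto_powr tendsto_add tendsto_const x) (auto simp: add_nonneg_eq_0_iff)
    moreover have "eventually (\<lambda>n. 1 - ((1 - 1 / (1 + env_B a c (k n))) * ((x n / h n) powr (-\<theta>) + 1)) powr (-1/\<theta>)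
        = cond_limit_pgf \<theta> (env_B a c (k n)) (exp (- (u * h n)))) F"
      using B_pos
    proof eventually_elim
      case (elim n)
      then have h: "0 < h n" "h n powr (-\<theta>) = env_B a c (k n)"
        using theta_pos by (auto simp: h_def powr_powr)
      then have x: "0 < x n"
        using u by (simp add: x_def)
      have "(x n / h n) powr (-\<theta>) = x n powr (-\<theta>) / env_B a c (k n)"
        using h x by (subst powr_divide) auto
      \<comment> \<open>Here \<open>\<beta>\<close> stands for \<open>env_B\<close> and
        \<open>y\<close> for \<open>x n powr (-\<theta>)\<close>; the right side is the base in
        \<open>cond_limit_pgf\<close>.\<close>
      moreover have "(1 - 1 / (1 + \<beta>)) * (y / \<beta> + 1) = 1 / (1 + \<beta>) * y + \<beta> / (1 + \<beta>)"
        if "0 < \<beta>" for \<beta> y :: real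
        using that by (simp add: divide_simps)
      ultimately show ?case
        using elim x u h by (simp add: cond_limit_pgf_def theta_map_def x_def)
    qed
    ultimately have "((\<lambda>n. cond_limit_pgf \<theta> (env_B a c (k n)) (exp (- (u * h n)))) \<longlongrightarrow>
        1 - ((1 - 0) * (u powr (-\<theta>) + 1)) powr (-1/\<theta>)) F"
      by (rule Lim_transform_eventually)
    then show ?thesis
      using u by (simp add: theta_map_def)
  qed (simp add: cond_limit_pgf_def)
  then show ?thesis
    unfolding eq[symmetric] by (simp add: h_def)
qed

end

theorem theorem5:
  fixes M :: "'w measure" and \<theta> :: real and a c :: "nat \<Rightarrow> real"
    and p :: "nat \<Rightarrow> nat \<Rightarrow> real"
    and X :: "nat \<Rightarrow> nat \<Rightarrow> 'w \<Rightarrow> nat" and Z :: "nat \<Rightarrow> 'w \<Rightarrow> nat"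
  assumes "gw_theta_process M \<theta> a c p X Z"
    and "\<nexists>L::ereal. (\<lambda>n. ereal (env_B a c n)) \<longlonglongrightarrow> L"
  shows "extinction_prob M Z = 1 \<and>
    (\<forall>(k :: nat \<Rightarrow> nat) B :: ereal.
      strict_mono k \<and> B \<ge> 0 \<and> (\<lambda>n. ereal (env_B a c (k n))) \<longlonglongrightarrow> B \<longrightarrow>
      (B = \<infinity> \<longrightarrow>
        asymp_equiv (\<lambda>n. \<P>(w in M. Z (k n) w > 0)) sequentially
          (\<lambda>n. env_C a c (k n) powr (-1/\<theta>)) \<and>
        asymp_equiv (\<lambda>n. cond_expect M (\<lambda>w. real (Z (k n) w)) (\<lambda>w. Z (k n) w > 0)) sequentially
          (\<lambda>n. env_B a c (k n) powr (1/\<theta>)) \<and>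
        (\<forall>u::real. u \<ge> 0 \<longrightarrow>
          (\<lambda>n. cond_expect M (\<lambda>w. exp (- (u * env_B a c (k n) powr (-1/\<theta>)) * real (Z (k n) w)))
                 (\<lambda>w. Z (k n) w > 0))
            \<longlonglongrightarrow> 1 - theta_map \<theta> 1 1 u)) \<and>
      (\<forall>b::real. B = ereal b \<longrightarrow>
        filterlim (\<lambda>n. env_A a (k n)) at_top sequentially \<and>
        asymp_equiv (\<lambda>n. \<P>(w in M. Z (k n) w > 0)) sequentially
          (\<lambda>n. (1 + b) powr (-1/\<theta>) * env_A a (k n) powr (-1/\<theta>)) \<and>
        (\<lambda>n. cond_expect M (\<lambda>w. real (Z (k n) w)) (\<lambda>w. Z (k n) w > 0))
            \<longlonglongrightarrow> (1 + b) powr (1/\<theta>) \<and>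
        (\<forall>s::real. 0 \<le> s \<and> s \<le> 1 \<longrightarrow>
          (\<lambda>n. cond_expect M (\<lambda>w. s ^ Z (k n) w) (\<lambda>w. Z (k n) w > 0))
            \<longlonglongrightarrow> cond_limit_pgf \<theta> b s)))"
proof -
  interpret gw_theta_process M \<theta> a c p X Z
    by fact
  \<comment> \<open>This divergence gives extinction and, along subsequences with a finite limit,
    the growth of \<open>env_A\<close>. The other claims are limits of exact formulas.\<close>
  note AC = env_AC_at_top[OF assms(2)]
  show ?thesis
  proof (intro conjI allI impI; (elim conjE)?)
    show "extinction_prob M Z = 1"
      by (rule extinction_prob_eq_1[OF AC])
  next
    fix k :: "nat \<Rightarrow> nat" and B :: ereal and u :: real
    assume "(\<lambda>n. ereal (env_B a c (k n))) \<longlonglongrightarrow> B" "B = \<infinity>"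
    then have "filterlim (\<lambda>n. env_B a c (k n)) at_top sequentially"
      by (simp add: tendsto_PInfty_eq_at_top)
    show "(\<lambda>n. prob {w \<in> space M. 0 < Z (k n) w}) \<sim>[sequentially] (\<lambda>n. env_C a c (k n) powr (-1/\<theta>))"
      by (rule survival_asymp_infinite) fact
    show "(\<lambda>n. cond_expect M (\<lambda>w. real (Z (k n) w)) (\<lambda>w. 0 < Z (k n) w)) \<sim>[sequentially]
        (\<lambda>n. env_B a c (k n) powr (1/\<theta>))"
      by (rule cond_mean_asymp) fact
    show "(\<lambda>n. cond_expect M (\<lambda>w. exp (- (u * env_B a c (k n) powr (-1/\<theta>)) * real (Z (k n) w)))
        (\<lambda>w. 0 < Z (k n) w)) \<longlonglongrightarrow> 1 - theta_map \<theta> 1 1 u" if "0 \<le> u"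
      by (rule cond_laplace_tendsto) fact+
  next
    fix k :: "nat \<Rightarrow> nat" and B :: ereal and b s :: real
    assume k: "strict_mono k" and "0 \<le> B" "(\<lambda>n. ereal (env_B a c (k n))) \<longlonglongrightarrow> B" "B = ereal b"
    then have B: "(\<lambda>n. env_B a c (k n)) \<longlonglongrightarrow> b" "0 \<le> b"
      by auto
    have "filterlim (\<lambda>n. env_A a (k n) + env_C a c (k n)) at_top sequentially"
      by (rule filterlim_compose[OF AC filterlim_subseq[OF k]])
    then show "filterlim (\<lambda>n. env_A a (k n)) at_top sequentially"
      by (rule env_A_at_top) fact+
    show "(\<lambda>n. prob {w \<in> space M. 0 < Z (k n) w}) \<sim>[sequentially]
        (\<lambda>n. (1 + b) powr (-1/\<theta>) * env_A a (k n) powr (-1/\<theta>))"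
      by (rule survival_asymp_finite) fact+
    show "(\<lambda>n. cond_expect M (\<lambda>w. real (Z (k n) w)) (\<lambda>w. 0 < Z (k n) w)) \<longlonglongrightarrow> (1 + b) powr (1/\<theta>)"
      by (rule cond_mean_tendsto) fact+
    show "(\<lambda>n. cond_expect M (\<lambda>w. s ^ Z (k n) w) (\<lambda>w. 0 < Z (k n) w)) \<longlonglongrightarrow> cond_limit_pgf \<theta> b s"
      if "0 \<le> s" "s \<le> 1"
      by (rule cond_pgf_tendsto) fact+
  qed
qed

end
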